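(* Let $A$ be a left nilpotent skew left brace and let $I$ be a non-zero left ideal of $A$. Then $I\cap\mathrm{Fix}(A)\neq 0$.
   Context: A skew left brace is a triple $(A,+,\circ)$ where $(A,+)$ and $(A,\circ)$ are (not necessarily abelian) groups such that $a\circ(b+c)=a\circ b-a+a\circ c$ for all $a,b,c\in A$. The two groups share the same neutral element $0$. For $a,b\in A$ put $\lambda_a(b)=-a+a\circ b$ and $a*b=-a+a\circ b-b$. For subsets $X,Y\subseteq A$, $X*Y$ denotes the subgroup of $(A,+)$ generated by all $x*y$ with $x\in X$, $y\in Y$. The left series of $A$ is $A^1=A$, $A^{n+1}=A*A^n$ for $n\ge 1$; $A$ is left nilpotent if $A^m=0$ for some $m\ge 1$. A left ideal of $A$ is a subgroup $I$ of $(A,+)$ such that $\lambda_a(I)\subseteq I$ for all $a\in A$. Finally, $\mathrm{Fix}(A)=\{a\in A:\lambda_x(a)=a\text{ for all }x\in A\}$. *)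

theory Defs
  imports "HOL-Algebra.Algebra"
begin

text \<open>
  The two operations of a skew left brace are carried by the \<open>ring\<close> record: \<open>\<oplus>\<close>, \<open>\<zero>\<close>, \<open>\<ominus>\<close> are those
  of \<open>(A,+)\<close>, and \<open>\<otimes>\<close>, \<open>\<one>\<close> are those of \<open>(A,\<circ>)\<close>. Only the record is shared with rings: neither
  operation is assumed commutative, and only a skew form of left distributivity holds.
  Since \<open>(A,+)\<close> need not be abelian, \<open>a_minus\<close> is used strictly as \<open>x \<ominus> y = x \<oplus> (\<ominus> y)\<close>.
\<close>

locale skew_left_brace = group A for A :: "('a, 'b) ring_scheme" (structure) +
  assumes add_group: "group (add_monoid A)"
    and skew_distrib: "\<lbrakk>a \<in> carrier A; b \<in> carrier A; c \<in> carrier A\<rbrakk>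
      \<Longrightarrow> a \<otimes> (b \<oplus> c) = (a \<otimes> b) \<ominus> a \<oplus> (a \<otimes> c)"

definition brace_lambda :: "('a, 'b) ring_scheme \<Rightarrow> 'a \<Rightarrow> 'a \<Rightarrow> 'a" where
  "brace_lambda A a b = (\<ominus>\<^bsub>A\<^esub> a) \<oplus>\<^bsub>A\<^esub> (a \<otimes>\<^bsub>A\<^esub> b)"

definition brace_star :: "('a, 'b) ring_scheme \<Rightarrow> 'a \<Rightarrow> 'a \<Rightarrow> 'a" where
  "brace_star A a b = (\<ominus>\<^bsub>A\<^esub> a) \<oplus>\<^bsub>A\<^esub> (a \<otimes>\<^bsub>A\<^esub> b) \<ominus>\<^bsub>A\<^esub> b"

definition brace_star_set :: "('a, 'b) ring_scheme \<Rightarrow> 'a set \<Rightarrow> 'a set \<Rightarrow> 'a set" where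
  "brace_star_set A S T = generate (add_monoid A) {brace_star A x y | x y. x \<in> S \<and> y \<in> T}"

text \<open>The left series starts at index 1; the value at index 0 is a dummy.\<close>

fun left_series :: "('a, 'b) ring_scheme \<Rightarrow> nat \<Rightarrow> 'a set" where
  "left_series A 0 = carrier A"
| "left_series A (Suc 0) = carrier A"
| "left_series A (Suc (Suc n)) = brace_star_set A (carrier A) (left_series A (Suc n))"

definition left_nilpotent :: "('a, 'b) ring_scheme \<Rightarrow> bool" where
  "left_nilpotent A \<longleftrightarrow> (\<exists>m\<ge>1. left_series A m = {\<zero>\<^bsub>A\<^esub>})"

definition left_ideal :: "'a set \<Rightarrow> ('a, 'b) ring_scheme \<Rightarrow> bool" where
  "left_ideal I A \<longleftrightarrow>
     subgroup I (add_monoid A) \<and> (\<forall>a\<in>carrier A. brace_lambda A a ` I \<subseteq> I)"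

definition brace_Fix :: "('a, 'b) ring_scheme \<Rightarrow> 'a set" where
  "brace_Fix A = {a \<in> carrier A. \<forall>x\<in>carrier A. brace_lambda A x a = a}"

context skew_left_brace
begin

lemma one_eq_zero: "\<one> = \<zero>"
proof -
  interpret add: group "add_monoid A" by (rule add_group)
  have z: "\<zero> \<in> carrier A" using add.one_closed by simp
  have "\<one> \<otimes> (\<zero> \<oplus> \<zero>) = (\<one> \<otimes> \<zero>) \<ominus> \<one> \<oplus> (\<one> \<otimes> \<zero>)"
    by (rule skew_distrib) (use z in auto)
  then have "\<zero> = \<ominus> \<one>"
    using z add.l_one[of "\<zero>"] add.r_one[of "\<ominus> \<one>"] add.l_one[of "\<ominus> \<one>"] add.inv_closed[of "\<one>"]
    by (simp add: a_minus_def a_inv_def)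
  then show ?thesis
    using add.inv_inv[of "\<one>"] add.inv_one by (simp add: a_inv_def)
qed

lemma zero_in_Fix: "\<zero> \<in> brace_Fix A"
proof -
  interpret add: group "add_monoid A" by (rule add_group)
  have "brace_lambda A x \<zero> = \<zero>" if "x \<in> carrier A" for x
    using that add.l_inv[of x] r_one[of x] one_eq_zero by (simp add: brace_lambda_def a_inv_def)
  then show ?thesis using add.one_closed by (simp add: brace_Fix_def)
qed

end

end

theory Submission
  imports Defs
begin

text \<open>
  By left nilpotency there is \<open>n\<close> with \<open>I \<inter> A\<^sup>n \<noteq> 0\<close> and \<open>I \<inter> A\<^sup>n\<^sup>+\<^sup>1 = 0\<close>.
  For \<open>x \<in> I \<inter> A\<^sup>n\<close> and any \<open>a\<close>, the element \<open>a * x = \<lambda>\<^sub>a(x) - x\<close> lies in \<open>I \<inter> A\<^sup>n\<^sup>+\<^sup>1 = 0\<close>, so \<open>x\<close> is fixed.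
\<close>

lemma brace_star_eq: "brace_star A a b = brace_lambda A a b \<ominus>\<^bsub>A\<^esub> b"
  by (simp add: brace_star_def brace_lambda_def)

context skew_left_brace
begin

text \<open>Ensures that a left ideal whose intersection with a term of the series is not
  \<open>{\<zero>}\<close> shares a non-zero element with it, the intersection never being
  empty.\<close>

lemma zero_in_left_series: "\<zero> \<in> left_series A n"
proof -
  interpret add: group "add_monoid A" by (rule add_group)
  show ?thesis
    using add.one_closed generate.one[of "add_monoid A"]
    by (cases "(A, n)" rule: left_series.cases) (simp_all add: brace_star_set_def)
qed

lemma brace_star_in_left_series:
  assumes "a \<in> carrier A" "x \<in> left_series A (Suc n)"
  shows "brace_star A a x \<in> left_series A (Suc (Suc n))"
  unfolding left_series.simps brace_star_set_def using assms by (blast intro: generate.incl)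

lemma brace_star_in_left_ideal:
  assumes "left_ideal I A" "a \<in> carrier A" "x \<in> I"
  shows "brace_star A a x \<in> I"
proof -
  have I: "subgroup I (add_monoid A)" and "brace_lambda A a x \<in> I"
    using assms by (auto simp: left_ideal_def)
  then show ?thesis
    using subgroup.m_closed[OF I] subgroup.m_inv_closed[OF I] \<open>x \<in> I\<close>
    by (simp add: brace_star_eq a_minus_def a_inv_def)
qed

lemma brace_lambda_eq_of_brace_star_zero:
  assumes "a \<in> carrier A" "x \<in> carrier A" "brace_star A a x = \<zero>"
  shows "brace_lambda A a x = x"
proof -
  interpret add: group "add_monoid A" by (rule add_group)
  have "brace_lambda A a x \<in> carrier A"
    using assms add.m_closed add.inv_closed by (simp add: brace_lambda_def a_inv_def)
  moreover have "brace_lambda A a x \<oplus> inv\<^bsub>add_monoid A\<^esub> x = \<zero>"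
    using assms by (simp add: brace_star_eq a_minus_def a_inv_def)
  ultimately show ?thesis
    \<comment> \<open>As a left inverse of \<open>-x\<close>, the element
      \<open>brace_lambda A a x\<close> equals \<open>-(-x) = x\<close>.\<close>
    using add.inv_equality[of "brace_lambda A a x" "inv\<^bsub>add_monoid A\<^esub> x"]
      add.inv_closed[of x] assms by simp
qed

end

theorem proposition2p26:
  fixes A :: "('a, 'b) ring_scheme" and I :: "'a set"
  assumes "skew_left_brace A"
    and "left_nilpotent A"
    and "left_ideal I A"
    and "I \<noteq> {\<zero>\<^bsub>A\<^esub>}"
  shows "I \<inter> brace_Fix A \<noteq> {\<zero>\<^bsub>A\<^esub>}"
proof -
  interpret skew_left_brace A by (rule assms(1))
  have I: "subgroup I (add_monoid A)" using assms(3) by (simp add: left_ideal_def)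
  have I_carrier: "I \<subseteq> carrier A" and I_zero: "\<zero>\<^bsub>A\<^esub> \<in> I"
    using subgroup.subset[OF I] subgroup.one_closed[OF I] by auto
  \<comment> \<open>The shift by \<open>Suc\<close> skips the dummy index 0, so \<open>P 0\<close>
    speaks of the whole carrier.\<close>
  define P where "P n \<longleftrightarrow> I \<inter> left_series A (Suc n) = {\<zero>\<^bsub>A\<^esub>}" for n
  obtain m where "m \<ge> 1" "left_series A m = {\<zero>\<^bsub>A\<^esub>}"
    using assms(2) by (auto simp: left_nilpotent_def)
  then have "P (m - 1)" using I_zero by (simp add: P_def)
  moreover have "\<not> P 0" using assms(4) I_carrier by (auto simp: P_def)
  \<comment> \<open>If \<open>\<not> P\<close> passed from every \<open>k\<close> to
    \<open>Suc k\<close>, induction from \<open>\<not> P 0\<close> would refute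
    \<open>P (m - 1)\<close>; so it fails to pass at some \<open>n\<close>.\<close>
  ultimately obtain n where n: "\<not> P n" "P (Suc n)"
    using nat_induct[of "\<lambda>k. \<not> P k"] by blast
  obtain x where x: "x \<in> I" "x \<in> left_series A (Suc n)" "x \<noteq> \<zero>\<^bsub>A\<^esub>"
    using n(1) I_zero zero_in_left_series[of "Suc n"] by (auto simp: P_def)
  have "brace_lambda A a x = x" if a: "a \<in> carrier A" for a
  proof -
    have "brace_star A a x = \<zero>\<^bsub>A\<^esub>"
      using brace_star_in_left_ideal[OF assms(3) a x(1)] brace_star_in_left_series[OF a x(2)] n(2)
      unfolding P_def by blast
    then show ?thesis using brace_lambda_eq_of_brace_star_zero a x(1) I_carrier by blast
  qed
  then have "x \<in> I \<inter> brace_Fix A" using x(1) I_carrier by (auto simp: brace_Fix_def)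
  then show ?thesis using x(3) by blast
qed

end
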